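(* Every directed tree admits an upward-leftward planar L-drawing. However, there exists a directed tree with a fixed bimodal planar embedding that admits no upward-planar L-drawing respecting that embedding.
   Context: In an L-drawing of a digraph, vertices are points and each edge $e$ is drawn as a polyline consisting of a vertical segment incident to the tail of $e$ and a horizontal segment incident to the head of $e$. It is planar if distinct edges may overlap but do not cross; upward if for every edge the lowest endpoint of its vertical segment is its tail; upward-leftward if it is upward and every edge points to the left (the head lies to the left of the tail). A planar embedding is bimodal if at every vertex the incoming edges are consecutive in the cyclic order of incident edges. *)

theory Defs
  imports
    "HOL-Analysis.Line_Segment"
    "HOL-Combinatorics.Cycles"
    "HOL-Combinatorics.Orbits"
    "Graph_Theory.Digraph_Component"
begin

section \<open>Directed trees\<close>

text \<open>
  A directed tree is a finite digraph whose underlying undirected graph is a tree. The predicate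
  \<^const>\<open>tree\<close> does not say this: applied to a digraph it forbids only directed cycles.
  The vertices of a cycle are distinct, so a cycle of length at least 3 in \<^const>\<open>mk_symmetric\<close>
  is a cycle of the underlying simple graph; shorter ones just run back and forth along one edge.
  Antiparallel arcs, which \<^const>\<open>mk_symmetric\<close> merges, are excluded separately.
\<close>

definition directed_tree :: "'a pair_pre_digraph \<Rightarrow> bool" where
  "directed_tree G \<longleftrightarrow>
     pair_digraph G \<and>
     Digraph_Component.connected (with_proj G) \<and>
     (\<forall>u v. (u, v) \<in> parcs G \<longrightarrow> (v, u) \<notin> parcs G) \<and>
     \<not> (\<exists>c. pre_digraph.cycle (with_proj (mk_symmetric (with_proj G))) c \<and> 3 \<le> length c)"

definition incident_arcs :: "'a pair_pre_digraph \<Rightarrow> 'a \<Rightarrow> ('a \<times> 'a) set" where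
  "incident_arcs G v = in_arcs (with_proj G) v \<union> out_arcs (with_proj G) v"

definition other_end :: "'a \<Rightarrow> 'a \<times> 'a \<Rightarrow> 'a" where
  "other_end v a = (if v = fst a then snd a else fst a)"


section \<open>Planar embeddings\<close>

text \<open>
  An embedding is given by a rotation system: \<open>rot v\<close> lists the arcs incident to \<open>v\<close> in
  counterclockwise order, starting anywhere, so that only the list up to \<^const>\<open>rotate\<close> matters.
\<close>

type_synonym 'a rotation = "'a \<Rightarrow> ('a \<times> 'a) list"

definition rotation_system :: "'a pair_pre_digraph \<Rightarrow> 'a rotation \<Rightarrow> bool" where
  "rotation_system G rot \<longleftrightarrow>
     (\<forall>v \<in> pverts G. distinct (rot v) \<and> set (rot v) = incident_arcs G v)"

text \<open>
  Face tracing: the pair \<open>(v, a)\<close> stands for the arc \<open>a\<close> traversed starting from its end \<open>v\<close>,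
  regardless of its direction. Having arrived at the other end \<open>w\<close>, one continues along the arc
  that follows \<open>a\<close> in the rotation at \<open>w\<close>.
\<close>

definition face_succ :: "'a rotation \<Rightarrow> 'a \<times> ('a \<times> 'a) \<Rightarrow> 'a \<times> ('a \<times> 'a)" where
  "face_succ rot = (\<lambda>(v, a). let w = other_end v a in (w, cycle_of_list (rot w) a))"

definition faces :: "'a pair_pre_digraph \<Rightarrow> 'a rotation \<Rightarrow> ('a \<times> ('a \<times> 'a)) set set" where
  "faces G rot = orbit (face_succ rot) ` (SIGMA v : pverts G. incident_arcs G v)"

text \<open>
  For connected \<open>G\<close>: the rotation system has genus 0 (Euler's formula). Without arcs there is nothing
  to trace and the only rotation system is planar. The choice of an outer face is not recorded;
  an embedded tree has only one face.
\<close>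

definition planar_embedding :: "'a pair_pre_digraph \<Rightarrow> 'a rotation \<Rightarrow> bool" where
  "planar_embedding G rot \<longleftrightarrow>
     rotation_system G rot \<and>
     (parcs G \<noteq> {} \<longrightarrow> card (pverts G) + card (faces G rot) = card (parcs G) + 2)"

definition bimodal :: "'a pair_pre_digraph \<Rightarrow> 'a rotation \<Rightarrow> bool" where
  "bimodal G rot \<longleftrightarrow>
     (\<forall>v \<in> pverts G. \<exists>k ins outs. rotate k (rot v) = ins @ outs \<and>
        set ins = in_arcs (with_proj G) v \<and> set outs = out_arcs (with_proj G) v)"


section \<open>L-drawings\<close>

text \<open>
  As usual for L-drawings, no two vertices share an x-coordinate or a y-coordinate. Hence an
  L-drawing is determined by the vertex positions, both segments of every edge are nondegenerate,
  and no edge passes through a vertex that is not one of its ends.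
\<close>

definition L_drawing :: "'a pair_pre_digraph \<Rightarrow> ('a \<Rightarrow> real \<times> real) \<Rightarrow> bool" where
  "L_drawing G p \<longleftrightarrow> inj_on (fst \<circ> p) (pverts G) \<and> inj_on (snd \<circ> p) (pverts G)"

definition bend :: "('a \<Rightarrow> real \<times> real) \<Rightarrow> 'a \<times> 'a \<Rightarrow> real \<times> real" where
  "bend p a = (fst (p (fst a)), snd (p (snd a)))"

definition vertical_part :: "('a \<Rightarrow> real \<times> real) \<Rightarrow> 'a \<times> 'a \<Rightarrow> (real \<times> real) set" where
  "vertical_part p a = open_segment (p (fst a)) (bend p a)"

definition horizontal_part :: "('a \<Rightarrow> real \<times> real) \<Rightarrow> 'a \<times> 'a \<Rightarrow> (real \<times> real) set" where
  "horizontal_part p a = open_segment (bend p a) (p (snd a))"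

text \<open>
  Collinear segments of two edges meet only if the edges have the same tail (vertical segments) or
  the same head (horizontal segments), because the coordinates are distinct. Such overlaps start at
  the common end and are allowed. A vertical and a horizontal segment of two edges that meet at an
  end of one of them do so at a common end vertex or within such an overlap. So two edges cross
  exactly if the interior of a vertical segment meets the interior of a horizontal one.
\<close>

definition edges_cross :: "('a \<Rightarrow> real \<times> real) \<Rightarrow> 'a \<times> 'a \<Rightarrow> 'a \<times> 'a \<Rightarrow> bool" where
  "edges_cross p a b \<longleftrightarrow>
     vertical_part p a \<inter> horizontal_part p b \<noteq> {} \<or>
     vertical_part p b \<inter> horizontal_part p a \<noteq> {}"

definition planar_L_drawing :: "'a pair_pre_digraph \<Rightarrow> ('a \<Rightarrow> real \<times> real) \<Rightarrow> bool" where
  "planar_L_drawing G p \<longleftrightarrow>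
     L_drawing G p \<and> (\<forall>a \<in> parcs G. \<forall>b \<in> parcs G. a \<noteq> b \<longrightarrow> \<not> edges_cross p a b)"

definition upward :: "'a pair_pre_digraph \<Rightarrow> ('a \<Rightarrow> real \<times> real) \<Rightarrow> bool" where
  "upward G p \<longleftrightarrow> (\<forall>a \<in> parcs G. snd (p (fst a)) < snd (bend p a))"

definition leftward :: "'a pair_pre_digraph \<Rightarrow> ('a \<Rightarrow> real \<times> real) \<Rightarrow> bool" where
  "leftward G p \<longleftrightarrow> (\<forall>a \<in> parcs G. fst (p (snd a)) < fst (p (fst a)))"

definition upward_planar_L_drawing :: "'a pair_pre_digraph \<Rightarrow> ('a \<Rightarrow> real \<times> real) \<Rightarrow> bool" where
  "upward_planar_L_drawing G p \<longleftrightarrow> planar_L_drawing G p \<and> upward G p"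

definition upward_leftward_planar_L_drawing ::
    "'a pair_pre_digraph \<Rightarrow> ('a \<Rightarrow> real \<times> real) \<Rightarrow> bool" where
  "upward_leftward_planar_L_drawing G p \<longleftrightarrow> upward_planar_L_drawing G p \<and> leftward G p"


section \<open>The embedding of an L-drawing\<close>

text \<open>
  The counterclockwise order of the arcs around \<open>v\<close> in an L-drawing. First comes the direction in
  which the arc leaves \<open>v\<close>: east, north, west, south. Arcs leaving in the same direction overlap up
  to the first of their bends, where one of them turns off; their order is the one obtained by
  drawing them apart slightly. Counterclockwise, those turning right (clockwise) come first, nearest
  bend first, and then those turning left, nearest bend last. So they are ordered by
  \<open>-1/l\<close> and \<open>1/l\<close> respectively, where \<open>l\<close> is the distance from \<open>v\<close> to the bend.
  The sign of the turn is that of the cross product of the two segments of the arc.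
\<close>

definition quadrant :: "real \<times> real \<Rightarrow> nat" where
  "quadrant d = (if fst d > 0 then 0 else if snd d > 0 then 1 else if fst d < 0 then 2 else 3)"

definition cross_prod :: "real \<times> real \<Rightarrow> real \<times> real \<Rightarrow> real" where
  "cross_prod d e = fst d * snd e - snd d * fst e"

definition turn :: "('a \<Rightarrow> real \<times> real) \<Rightarrow> 'a \<Rightarrow> 'a \<times> 'a \<Rightarrow> real" where
  "turn p v a =
     sgn (cross_prod (bend p a - p v) (p (other_end v a) - bend p a)) / dist (p v) (bend p a)"

definition ccw_before :: "('a \<Rightarrow> real \<times> real) \<Rightarrow> 'a \<Rightarrow> 'a \<times> 'a \<Rightarrow> 'a \<times> 'a \<Rightarrow> bool" where
  "ccw_before p v a b \<longleftrightarrow>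
     (let i = quadrant (bend p a - p v); j = quadrant (bend p b - p v)
      in i < j \<or> i = j \<and> turn p v a < turn p v b)"

definition respects_embedding ::
    "'a pair_pre_digraph \<Rightarrow> 'a rotation \<Rightarrow> ('a \<Rightarrow> real \<times> real) \<Rightarrow> bool" where
  "respects_embedding G rot p \<longleftrightarrow>
     (\<forall>v \<in> pverts G. \<exists>k. sorted_wrt (ccw_before p v) (rotate k (rot v)))"

end

(*
  A directed tree is drawn leaf by leaf: a new leaf is placed on the antidiagonal through its
  neighbour, above it if the edge enters the leaf and below it otherwise, so close that no other
  coordinate lies in between.

  For the counterexample, let v have two outgoing edges to b and b', each of which also has incoming
  edges on both sides of the one from v, in the given embedding. In an upward-planar L-drawing the
  tails of the edges entering b are ordered from left to right as prescribed, so v lies strictly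
  between the outer two and the horizontal segments at b pass over v. Hence b' cannot be higher than
  b; by symmetry b cannot be higher than b'.
*)

theory Submission
  imports Defs
begin

section \<open>Drawing trees leaf by leaf\<close>

text \<open>Each part is the product of a fixed coordinate with an open interval in the other one,
  so meeting splits into one condition on x and one on y.\<close>

lemma vertical_meets_horizontal_iff:
  "vertical_part p a \<inter> horizontal_part p b \<noteq> {} \<longleftrightarrow>
     fst (p (fst a)) \<in> open_segment (fst (p (fst b))) (fst (p (snd b))) \<and>
     snd (p (snd b)) \<in> open_segment (snd (p (fst a))) (snd (p (snd a)))"
proof -
  have v: "vertical_part p a = {fst (p (fst a))} \<times> open_segment (snd (p (fst a))) (snd (p (snd a)))"
    by (cases "p (fst a)")
       (auto simp: vertical_part_def bend_def in_segment algebra_simps intro: prod_eqI)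
  have h: "horizontal_part p b = open_segment (fst (p (fst b))) (fst (p (snd b))) \<times> {snd (p (snd b))}"
    by (cases "p (snd b)")
       (auto simp: horizontal_part_def bend_def in_segment algebra_simps intro: prod_eqI)
  show ?thesis
    unfolding v h by auto
qed

text \<open>Supplies the gap around the coordinates of a vertex into which a new leaf is
  placed.\<close>

lemma finite_reals_isolated:
  fixes x :: "'b \<Rightarrow> real"
  assumes "finite S"
  obtains e where "0 < e" "\<And>v. v \<in> S \<Longrightarrow> x v \<noteq> c \<Longrightarrow> e < \<bar>x v - c\<bar>"
proof -
  obtain d where d: "0 < d" "\<forall>t\<in>x ` S. t \<noteq> c \<longrightarrow> d \<le> dist c t"
    using finite_set_avoid[of "x ` S" c] assms by auto
  show thesis
  \<comment> \<open>Halving turns a weak bound into a strict one, so positions at distance exactly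
    \<open>e\<close> from \<open>c\<close> are free as well.\<close>
  proof (rule that[of "d / 2"])
    show "0 < d / 2"
      using d(1) by simp
    show "d / 2 < \<bar>x v - c\<bar>" if "v \<in> S" "x v \<noteq> c" for v
      using d that by (force simp: dist_real_def abs_minus_commute)
  qed
qed

text \<open>No old vertex gets a coordinate strictly between those of \<open>u\<close> and
  \<open>w\<close>. A crossing of the new edge with an old one would need the x-coordinate of the
  old tail or the y-coordinate of the old head to lie there.\<close>

lemma upward_leftward_add_leaf:
  assumes D: "upward_leftward_planar_L_drawing \<lparr>pverts = S, parcs = A\<rparr> p"
    and fin: "finite S" and A: "A \<subseteq> S \<times> S" and u: "u \<in> S" and w: "w \<notin> S"
    and a: "a = (u, w) \<or> a = (w, u)"
  shows "\<exists>q. upward_leftward_planar_L_drawing \<lparr>pverts = insert w S, parcs = insert a A\<rparr> q"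
proof -
  let ?x = "\<lambda>v. fst (p v)" and ?y = "\<lambda>v. snd (p v)"
  have inj: "inj_on ?x S" "inj_on ?y S"
    and noX: "\<And>b c. b \<in> A \<Longrightarrow> c \<in> A \<Longrightarrow> b \<noteq> c \<Longrightarrow> \<not> edges_cross p b c"
    and up: "\<And>b. b \<in> A \<Longrightarrow> ?y (fst b) < ?y (snd b)"
    and left: "\<And>b. b \<in> A \<Longrightarrow> ?x (snd b) < ?x (fst b)"
    using D by (auto simp: upward_leftward_planar_L_drawing_def upward_planar_L_drawing_def
        planar_L_drawing_def L_drawing_def upward_def leftward_def bend_def comp_def)
  obtain e1 where e1: "0 < e1" "\<And>v. v \<in> S \<Longrightarrow> ?x v \<noteq> ?x u \<Longrightarrow> e1 < \<bar>?x v - ?x u\<bar>"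
    using finite_reals_isolated[OF fin, of ?x "?x u"] by blast
  obtain e2 where e2: "0 < e2" "\<And>v. v \<in> S \<Longrightarrow> ?y v \<noteq> ?y u \<Longrightarrow> e2 < \<bar>?y v - ?y u\<bar>"
    using finite_reals_isolated[OF fin, of ?y "?y u"] by blast
  define e where "e = min e1 e2"
  have e: "0 < e" and ex: "\<And>v. v \<in> S \<Longrightarrow> ?x v = ?x u \<or> e < \<bar>?x v - ?x u\<bar>"
    and ey: "\<And>v. v \<in> S \<Longrightarrow> ?y v = ?y u \<or> e < \<bar>?y v - ?y u\<bar>"
    using e1 e2 by (fastforce simp: e_def)+
  \<comment> \<open>The sign puts \<open>w\<close> to the upper left of \<open>u\<close> if
    \<open>w\<close> is the head, and to the lower right if it is the tail; the edge points up and
    left either way.\<close>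
  define s where "s = (if a = (u, w) then e else - e)"
  have s: "\<bar>s\<bar> = e"
    using e by (simp add: s_def)
  define q where "q = p(w := (?x u - s, ?y u + s))"
  have qS: "q v = p v" if "v \<in> S" for v
    using that w by (auto simp: q_def)
  have qw: "q w = (?x u - s, ?y u + s)"
    by (simp add: q_def)
  have new_x: "fst (q w) \<noteq> ?x v" and new_y: "snd (q w) \<noteq> ?y v" if "v \<in> S" for v
    using ex[OF that] ey[OF that] e s by (auto simp: qw)
  have "inj_on (\<lambda>v. fst (q v)) S" "inj_on (\<lambda>v. snd (q v)) S"
    using inj by (auto simp: inj_on_def qS)
  then have "L_drawing \<lparr>pverts = insert w S, parcs = insert a A\<rparr> q"
    using new_x new_y w by (auto simp: L_drawing_def comp_def inj_on_insert qS)
  moreover have "\<not> edges_cross q b c" if "b \<in> insert a A" "c \<in> insert a A" "b \<noteq> c" for b c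
  proof -
    have old: "\<not> edges_cross q b c" if "b \<in> A" "c \<in> A" "b \<noteq> c" for b c
    proof -
      have "fst b \<in> S" "snd b \<in> S" "fst c \<in> S" "snd c \<in> S"
        using that A by auto
      with noX[OF that] show ?thesis
        by (simp add: edges_cross_def vertical_meets_horizontal_iff qS)
    qed
    have new: "\<not> edges_cross q a c" if "c \<in> A" for c
    proof -
      have c: "fst c \<in> S" "snd c \<in> S"
        using that A by auto
      \<comment> \<open>Only the tail's x and the head's y matter: they locate the vertical and the
        horizontal segment of \<open>c\<close>. Both signs of \<open>s\<close> are covered.\<close>
      have gap: "\<not> (?x u - e < ?x (fst c) \<and> ?x (fst c) < ?x u)"
        "\<not> (?x u < ?x (fst c) \<and> ?x (fst c) < ?x u + e)"
        "\<not> (?y u - e < ?y (snd c) \<and> ?y (snd c) < ?y u)"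
        "\<not> (?y u < ?y (snd c) \<and> ?y (snd c) < ?y u + e)"
        using ex[OF c(1)] ey[OF c(2)] by linarith+
      have "(a = (u, w) \<and> s = e) \<or> (a = (w, u) \<and> s = - e)"
        using a u w by (auto simp: s_def)
      then show ?thesis
        using gap e
        by (elim disjE conjE)
           (simp_all add: edges_cross_def vertical_meets_horizontal_iff open_segment_eq_real_ivl
            qS[OF c(1)] qS[OF c(2)] qS[OF u] qw, blast+)
    qed
    have sym: "edges_cross q b c \<longleftrightarrow> edges_cross q c b" for b c
      by (auto simp: edges_cross_def)
    show ?thesis
      using that old new sym by blast
  qed
  moreover have "snd (q (fst b)) < snd (q (snd b)) \<and> fst (q (snd b)) < fst (q (fst b))"
    if "b \<in> insert a A" for b
  proof (cases "b \<in> A")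
    case True
    then show ?thesis
      using A up[OF True] left[OF True] by (auto simp: qS)
  next
    case False
    then show ?thesis
      using that a u w e by (auto simp: qS[OF u] qw s_def)
  qed
  ultimately have "upward_leftward_planar_L_drawing \<lparr>pverts = insert w S, parcs = insert a A\<rparr> q"
    unfolding upward_leftward_planar_L_drawing_def upward_planar_L_drawing_def planar_L_drawing_def
      upward_def leftward_def bend_def fst_conv snd_conv pair_pre_digraph.simps
    by blast
  then show ?thesis
    by blast
qed

section \<open>Connected vertex sets and how a vertex attaches to them\<close>

text \<open>Connectedness of the subgraph induced by \<open>S\<close>. Simple paths are demanded so
  that closing one up through a vertex outside \<open>S\<close> gives a \<open>cycle\<close>, whose
  vertices must be distinct.\<close>

definition path_connected_in :: "'a pair_pre_digraph \<Rightarrow> 'a set \<Rightarrow> bool" where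
  "path_connected_in H S \<longleftrightarrow>
     (\<forall>u\<in>S. \<forall>v\<in>S. \<exists>p. set p \<subseteq> parcs H \<and> pcas u p v \<and>
        distinct (pawalk_verts u p) \<and> set (pawalk_verts u p) \<subseteq> S)"

lemma pcas_append_arc:
  "pcas u (p @ [(v, w)]) w' \<longleftrightarrow> pcas u p v \<and> w = w'"
  by (induction p arbitrary: u) auto

lemma pawalk_verts_append_arc:
  "pcas u p v \<Longrightarrow> pawalk_verts u (p @ [(v, w)]) = pawalk_verts u p @ [w]"
  by (induction p arbitrary: u) auto

text \<open>A simple path inside \<open>S\<close> from or to \<open>u\<close> stays simple when
  prolonged to \<open>w\<close>, since \<open>w\<close> is new.\<close>

lemma path_connected_in_insert:
  assumes S: "path_connected_in H S" and u: "u \<in> S" and w: "w \<notin> S"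
    and arcs: "(u, w) \<in> parcs H" "(w, u) \<in> parcs H"
  shows "path_connected_in H (insert w S)"
  unfolding path_connected_in_def
proof (intro ballI)
  fix x y
  assume xy: "x \<in> insert w S" "y \<in> insert w S"
  let ?P = "\<lambda>S x y p. set p \<subseteq> parcs H \<and> pcas x p y \<and> distinct (pawalk_verts x p) \<and>
      set (pawalk_verts x p) \<subseteq> S"
  have S: "\<exists>p. ?P S x y p" if "x \<in> S" "y \<in> S" for x y
    using S that by (auto simp: path_connected_in_def)
  consider "x = w" "y = w" | "x = w" "y \<in> S" | "x \<in> S" "y = w" | "x \<in> S" "y \<in> S"
    using xy by auto
  then show "\<exists>p. ?P (insert w S) x y p"
  proof cases
    case 1
    then show ?thesis
      by (intro exI[of _ "[]"]) auto
  next
    case 2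
    with S[OF u] obtain p where "?P S u y p"
      by blast
    then show ?thesis
      using 2 w arcs by (intro exI[of _ "(w, u) # p"]) auto
  next
    case 3
    with S[OF _ u] obtain p where "?P S x u p"
      by blast
    then show ?thesis
      using 3 w arcs
      by (intro exI[of _ "p @ [(u, w)]"]) (auto simp: pcas_append_arc pawalk_verts_append_arc)
  next
    case 4
    with S obtain p where "?P S x y p"
      by blast
    then show ?thesis
      by (intro exI[of _ p]) auto
  qed
qed

text \<open>Otherwise a simple path from \<open>u\<close> to \<open>u'\<close> inside
  \<open>S\<close>, closed up through \<open>w\<close>, would be a forbidden cycle.\<close>

lemma unique_neighbour_of_path_connected:
  assumes acyc: "\<not> (\<exists>c. pre_digraph.cycle (with_proj H) c \<and> 3 \<le> length c)"
    and S: "path_connected_in H S" and w: "w \<in> pverts H" "w \<notin> S"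
    and u: "u \<in> S" "(w, u) \<in> parcs H" and u': "u' \<in> S" "(u', w) \<in> parcs H"
  shows "u = u'"
proof (rule ccontr)
  assume "u \<noteq> u'"
  obtain p where p: "set p \<subseteq> parcs H" "pcas u p u'" "distinct (pawalk_verts u p)"
      "set (pawalk_verts u p) \<subseteq> S"
    using S u(1) u'(1) unfolding path_connected_in_def by blast
  let ?c = "(w, u) # p @ [(u', w)]"
  have "pre_digraph.cycle (with_proj H) ?c"
    unfolding pre_digraph.cycle_def pre_digraph.awalk_def
    using p u u' w
    by (intro exI[of _ w])
       (auto simp: cas_with_proj_eq awalk_verts_with_proj_eq pcas_append_arc pawalk_verts_append_arc)
  \<comment> \<open>The path has at least one arc because its ends differ; the two arcs at
    \<open>w\<close> bring the length to 3.\<close>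
  moreover have "p \<noteq> []"
    using p \<open>u \<noteq> u'\<close> by auto
  then have "3 \<le> length ?c"
    by (cases p) auto
  ultimately show False
    using acyc by blast
qed

section \<open>Growing the drawing over the whole tree\<close>

lemma strongly_connected_leaving_arc:
  assumes "strongly_connected (with_proj H)" "S \<subseteq> pverts H" "S \<noteq> {}" "S \<noteq> pverts H"
  obtains u w where "u \<in> S" "w \<in> pverts H" "w \<notin> S" "(u, w) \<in> parcs H"
proof -
  obtain x y where xy: "x \<in> S" "y \<in> pverts H" "y \<notin> S"
    using assms by auto
  then have "(x, y) \<in> rtrancl_on (pverts H) (parcs H)"
    using assms by (auto simp: strongly_connected_def reachable_def)
  then have "\<exists>u w. u \<in> S \<and> w \<in> pverts H \<and> w \<notin> S \<and> (u, w) \<in> parcs H"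
    using xy(1,3) by (induction rule: rtrancl_on_induct) auto
  then show thesis
    using that by blast
qed

lemma directed_tree_upward_leftward:
  assumes "directed_tree G"
  shows "\<exists>p. upward_leftward_planar_L_drawing G p"
proof -
  define H where "H = mk_symmetric (with_proj G)"
  interpret pair_digraph G
    using assms by (simp add: directed_tree_def)
  have H: "pverts H = pverts G" "parcs H = parcs G \<union> (parcs G)\<inverse>"
    by (auto simp: H_def parcs_mk_symmetric)
  have con: "strongly_connected (with_proj H)"
    and anti: "\<And>u v. (u, v) \<in> parcs G \<Longrightarrow> (v, u) \<notin> parcs G"
    and acyc: "\<not> (\<exists>c. pre_digraph.cycle (with_proj H) c \<and> 3 \<le> length c)"
    using assms by (auto simp: directed_tree_def connected_def H_def)
  \<comment> \<open>Instead of removing leaves from \<open>G\<close>, a connected set whose induced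
    subgraph is already drawn is taken maximal; it turns out to contain every vertex.\<close>
  define Q where "Q S \<longleftrightarrow> S \<subseteq> pverts G \<and> S \<noteq> {} \<and> path_connected_in H S \<and>
      (\<exists>p. upward_leftward_planar_L_drawing \<lparr>pverts = S, parcs = parcs G \<inter> S \<times> S\<rparr> p)" for S
  obtain v where v: "v \<in> pverts G"
    using con by (auto simp: strongly_connected_def H)
  have "parcs G \<inter> {v} \<times> {v} = {}"
    using no_loops' by auto
  then have "Q {v}"
    using v by (auto simp: Q_def path_connected_in_def upward_leftward_planar_L_drawing_def
        upward_planar_L_drawing_def planar_L_drawing_def L_drawing_def upward_def leftward_def
        intro: exI[of _ "[]"])
  moreover have "finite {S. Q S}"
    by (rule finite_subset[of _ "Pow (pverts G)"]) (auto simp: Q_def pair_finite_verts)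
  ultimately obtain S where QS: "Q S" and max: "\<And>S'. Q S' \<Longrightarrow> S \<subseteq> S' \<Longrightarrow> S' = S"
    using finite_has_maximal[of "{S. Q S}"] by blast
  obtain p where S: "S \<subseteq> pverts G" "S \<noteq> {}" "path_connected_in H S"
    and p: "upward_leftward_planar_L_drawing \<lparr>pverts = S, parcs = parcs G \<inter> S \<times> S\<rparr> p"
    using QS by (auto simp: Q_def)
  have "S = pverts G"
  proof (rule ccontr)
    assume "S \<noteq> pverts G"
    then obtain u w where uw: "u \<in> S" "w \<in> pverts G" "w \<notin> S" "(u, w) \<in> parcs H"
      using strongly_connected_leaving_arc[OF con, of S] S by (auto simp: H)
    have wu: "(w, u) \<in> parcs H"
      using uw by (auto simp: H)
    have uniq: "u' = u" if "u' \<in> S" "(u', w) \<in> parcs H" for u'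
      using unique_neighbour_of_path_connected[OF acyc, of S w u u'] S uw wu that by (auto simp: H)
    obtain a where a: "a = (u, w) \<or> a = (w, u)" "a \<in> parcs G"
      using uw by (auto simp: H)
    \<comment> \<open>So \<open>w\<close> is a leaf of the enlarged tree: \<open>uniq\<close> leaves
      \<open>u\<close> as its only neighbour in \<open>S\<close>, and \<open>anti\<close> leaves
      only one orientation.\<close>
    have "parcs G \<inter> insert w S \<times> insert w S = insert a (parcs G \<inter> S \<times> S)"
    proof -
      have "(w, v) = a" if "(w, v) \<in> parcs G" "v \<in> S" for v
        using that a uniq[of v] anti by (auto simp: H)
      moreover have "(v, w) = a" if "(v, w) \<in> parcs G" "v \<in> S" for v
        using that a uniq[of v] anti by (auto simp: H)
      moreover have "(w, w) \<notin> parcs G"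
        using no_loops' by blast
      ultimately show ?thesis
        using a uw(1) by blast
    qed
    moreover have "finite S"
      using S pair_finite_verts finite_subset by blast
    ultimately have "\<exists>q. upward_leftward_planar_L_drawing
        \<lparr>pverts = insert w S, parcs = parcs G \<inter> insert w S \<times> insert w S\<rparr> q"
      using upward_leftward_add_leaf[OF p _ _ uw(1,3) a(1)] by simp
    then have "Q (insert w S)"
      using S uw wu path_connected_in_insert[of H S u w] by (simp add: Q_def)
    then show False
      using max[of "insert w S"] uw by auto
  qed
  moreover have "parcs G \<inter> pverts G \<times> pverts G = parcs G"
    using wellformed' by auto
  ultimately have "\<exists>p. upward_leftward_planar_L_drawing \<lparr>pverts = pverts G, parcs = parcs G\<rparr> p"
    using p by auto
  then show ?thesis
    by (cases G) simp
qed

section \<open>A bimodal embedding without an upward-planar L-drawing\<close>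

text \<open>Followed backwards from its head, an upward edge runs horizontally and then down. Hence
  the turn has the sign opposite to that of the horizontal offset, and \<open>turn\<close> increases
  with the x-coordinate of the tail on each side of \<open>v\<close>.\<close>

lemma upward_in_arc:
  assumes "L_drawing G p" "upward G p" "(u, v) \<in> parcs G" "u \<in> pverts G" "v \<in> pverts G" "u \<noteq> v"
  shows "quadrant (bend p (u, v) - p v) = (if fst (p u) > fst (p v) then 0 else 2)"
    and "turn p v (u, v) = - 1 / (fst (p u) - fst (p v))"
    and "fst (p u) \<noteq> fst (p v)"
proof -
  have y: "snd (p u) < snd (p v)"
    using assms by (auto simp: upward_def bend_def)
  show x: "fst (p u) \<noteq> fst (p v)"
    using assms by (auto simp: L_drawing_def inj_on_def)
  then show "quadrant (bend p (u, v) - p v) = (if fst (p u) > fst (p v) then 0 else 2)"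
    by (auto simp: quadrant_def bend_def)
  define d h where "d = fst (p u) - fst (p v)" and "h = snd (p u) - snd (p v)"
  have "dist (p v) (bend p (u, v)) = \<bar>d\<bar>"
    by (cases "p v") (auto simp: bend_def dist_Pair_Pair dist_real_def d_def)
  then have "turn p v (u, v) = sgn (d * h) / \<bar>d\<bar>"
    using \<open>u \<noteq> v\<close> by (simp add: turn_def cross_prod_def bend_def other_end_def d_def h_def)
  also have "sgn (d * h) = - sgn d"
    using y by (simp add: sgn_mult h_def)
  also have "- sgn d / \<bar>d\<bar> = - 1 / d"
    by (simp add: sgn_real_def abs_if)
  finally show "turn p v (u, v) = - 1 / (fst (p u) - fst (p v))"
    by (simp add: d_def)
qed

lemma upward_out_arc:
  assumes "upward G p" "(u, v) \<in> parcs G"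
  shows "quadrant (bend p (u, v) - p u) = 1"
  using assms by (auto simp: quadrant_def upward_def bend_def)

text \<open>Arcs arriving from the same side are compared by \<open>turn\<close>, hence left to
  right; otherwise the count starts in the east and the right-hand arc comes first.\<close>

lemma ccw_before_in_arcs:
  assumes D: "L_drawing G p" "upward G p"
    and u: "(u, v) \<in> parcs G" "u \<in> pverts G" "u \<noteq> v"
    and u': "(u', v) \<in> parcs G" "u' \<in> pverts G" "u' \<noteq> v"
    and v: "v \<in> pverts G"
  shows "ccw_before p v (u, v) (u', v) \<longleftrightarrow>
     (if (fst (p u) < fst (p v)) = (fst (p u') < fst (p v))
      then fst (p u) < fst (p u') else fst (p u') < fst (p v))"
proof -
  note q = upward_in_arc[OF D u(1,2) v u(3)] and q' = upward_in_arc[OF D u'(1,2) v u'(3)]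
  have "- 1 / (fst (p u) - fst (p v)) < - 1 / (fst (p u') - fst (p v)) \<longleftrightarrow> fst (p u) < fst (p u')"
    if "(fst (p u) < fst (p v)) = (fst (p u') < fst (p v))"
  proof -
    \<comment> \<open>Taking reciprocals reverses the order only between numbers of equal
      sign.\<close>
    have "0 < (fst (p u) - fst (p v)) * (fst (p u') - fst (p v))"
      using that q(3) q'(3) unfolding zero_less_mult_iff by linarith
    then show ?thesis
      using inverse_less_iff[of "fst (p u') - fst (p v)" "fst (p u) - fst (p v)"]
      by (simp add: inverse_eq_divide mult.commute)
  qed
  then show ?thesis
    using q(3) q'(3) by (auto simp: ccw_before_def Let_def q(1,2) q'(1,2) neq_iff)
qed

text \<open>An upward edge leaves its tail to the north, which is counted between east and
  west.\<close>

lemma ccw_before_in_out: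
  assumes D: "L_drawing G p" "upward G p"
    and u: "(u, v) \<in> parcs G" "u \<in> pverts G" "u \<noteq> v"
    and v: "v \<in> pverts G" "(v, t) \<in> parcs G"
  shows "ccw_before p v (u, v) (v, t) \<longleftrightarrow> fst (p v) < fst (p u)"
    and "ccw_before p v (v, t) (u, v) \<longleftrightarrow> fst (p u) < fst (p v)"
  using upward_in_arc[OF D u(1,2) v(1) u(3)] upward_out_arc[OF D(2) v(2)]
  by (auto simp: ccw_before_def Let_def)

text \<open>
  The outgoing arc marks where the cyclic order of the incoming ones is cut open.
\<close>

lemma in_arcs_left_to_right:
  assumes D: "L_drawing G p" "upward G p"
    and sorted: "sorted_wrt (ccw_before p b) (rotate k [(l, b), (v, b), (r, b), (b, t)])"
    and arcs: "(l, b) \<in> parcs G" "(v, b) \<in> parcs G" "(r, b) \<in> parcs G" "(b, t) \<in> parcs G"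
    and verts: "l \<in> pverts G" "v \<in> pverts G" "r \<in> pverts G" "b \<in> pverts G"
    and neq: "l \<noteq> b" "v \<noteq> b" "r \<noteq> b"
  shows "fst (p l) < fst (p v)" "fst (p v) < fst (p r)"
proof -
  let ?arcs = "[(l, b), (v, b), (r, b), (b, t)]" and ?B = "ccw_before p b"
  have "rotate 0 ?arcs = ?arcs" "rotate 1 ?arcs = [(v, b), (r, b), (b, t), (l, b)]"
    "rotate 2 ?arcs = [(r, b), (b, t), (l, b), (v, b)]"
    "rotate 3 ?arcs = [(b, t), (l, b), (v, b), (r, b)]"
    by (simp_all add: numeral_eq_Suc)
  moreover have "rotate k ?arcs = rotate (k mod 4) ?arcs"
    by (subst rotate_conv_mod) simp
  moreover have "k mod 4 = 0 \<or> k mod 4 = 1 \<or> k mod 4 = 2 \<or> k mod 4 = 3"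
    by auto
  ultimately consider "sorted_wrt ?B ?arcs" | "sorted_wrt ?B [(v, b), (r, b), (b, t), (l, b)]"
    | "sorted_wrt ?B [(r, b), (b, t), (l, b), (v, b)]"
    | "sorted_wrt ?B [(b, t), (l, b), (v, b), (r, b)]"
    using sorted by metis
  \<comment> \<open>Arcs before \<open>(b, t)\<close> arrive from the right and those after it from
    the left, so the four rotations are the four ways to split \<open>l\<close>, \<open>v\<close>,
    \<open>r\<close> between the two sides.\<close>
  then have cut:
    "?B (l, b) (v, b) \<and> ?B (v, b) (r, b) \<and> ?B (l, b) (b, t) \<and> ?B (v, b) (b, t) \<and> ?B (r, b) (b, t) \<or>
     ?B (v, b) (r, b) \<and> ?B (v, b) (b, t) \<and> ?B (r, b) (b, t) \<and> ?B (b, t) (l, b) \<or>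
     ?B (l, b) (v, b) \<and> ?B (r, b) (b, t) \<and> ?B (b, t) (l, b) \<and> ?B (b, t) (v, b) \<or>
     ?B (l, b) (v, b) \<and> ?B (v, b) (r, b) \<and> ?B (b, t) (l, b) \<and> ?B (b, t) (v, b) \<and> ?B (b, t) (r, b)"
    by cases simp_all
  note in_out = ccw_before_in_out[OF D arcs(1) verts(1) neq(1) verts(4) arcs(4)]
    ccw_before_in_out[OF D arcs(2) verts(2) neq(2) verts(4) arcs(4)]
    ccw_before_in_out[OF D arcs(3) verts(3) neq(3) verts(4) arcs(4)]
  note in_in = ccw_before_in_arcs[OF D arcs(1) verts(1) neq(1) arcs(2) verts(2) neq(2) verts(4)]
    ccw_before_in_arcs[OF D arcs(2) verts(2) neq(2) arcs(3) verts(3) neq(3) verts(4)]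
  have "fst (p l) < fst (p v) \<and> fst (p v) < fst (p r)"
    using cut unfolding in_out in_in by (elim disjE conjE) (simp_all split: if_splits)
  then show "fst (p l) < fst (p v)" "fst (p v) < fst (p r)"
    by auto
qed

lemma surrounded_out_neighbour_is_highest:
  assumes D: "upward_planar_L_drawing G p"
    and arcs: "(v, b) \<in> parcs G" "(v, b') \<in> parcs G" "(l, b) \<in> parcs G" "(r, b) \<in> parcs G"
    and verts: "v \<in> pverts G" "b \<in> pverts G" "v \<noteq> b"
    and x: "fst (p l) < fst (p v)" "fst (p v) < fst (p r)"
  shows "\<not> snd (p b) < snd (p b')"
proof
  assume y: "snd (p b) < snd (p b')"
  have "snd (p v) < snd (p b)" "fst (p v) \<noteq> fst (p b)"
    using D arcs verts by (auto simp: upward_planar_L_drawing_def upward_def bend_def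
        planar_L_drawing_def L_drawing_def inj_on_def)
  \<comment> \<open>If \<open>v\<close> is to the left of \<open>b\<close>, the horizontal segment
    of \<open>(l, b)\<close> passes over \<open>v\<close>; if it is to the right, that of
    \<open>(r, b)\<close> does.\<close>
  then have "edges_cross p (v, b') (l, b) \<or> edges_cross p (v, b') (r, b)"
    using x y by (auto simp: edges_cross_def vertical_meets_horizontal_iff open_segment_eq_real_ivl)
  moreover have "l \<noteq> v" "r \<noteq> v"
    using x by auto
  ultimately show False
    using D arcs by (auto simp: upward_planar_L_drawing_def planar_L_drawing_def)
qed

section \<open>The counterexample\<close>

text \<open>Vertex 0 is the vertex with two outgoing edges, to 1 and 2. The other tails at these are
  3, 4 and 6, 7; the out-neighbours 5 and 8 fix where the cyclic order of incoming arcs is cut.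
  Parents have smaller numbers when the tree is rooted at 0.\<close>

definition bad_tree :: "nat pair_pre_digraph" where
  "bad_tree = \<lparr>pverts = {0, 1, 2, 3, 4, 5, 6, 7, 8},
     parcs = {(0, 1), (0, 2), (3, 1), (4, 1), (1, 5), (6, 2), (7, 2), (2, 8)}\<rparr>"

definition bad_rot :: "nat rotation" where
  "bad_rot v =
     (if v = 0 then [(0, 1), (0, 2)]
      else if v = 1 then [(3, 1), (0, 1), (4, 1), (1, 5)]
      else if v = 2 then [(6, 2), (0, 2), (7, 2), (2, 8)]
      else if v = 3 then [(3, 1)]
      else if v = 4 then [(4, 1)]
      else if v = 5 then [(1, 5)]
      else if v = 6 then [(6, 2)]
      else if v = 7 then [(7, 2)]
      else [(2, 8)])"

lemma bad_tree_no_drawing: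
  "\<not> (\<exists>p. upward_planar_L_drawing bad_tree p \<and> respects_embedding bad_tree bad_rot p)"
proof
  assume "\<exists>p. upward_planar_L_drawing bad_tree p \<and> respects_embedding bad_tree bad_rot p"
  then obtain p where U: "upward_planar_L_drawing bad_tree p"
    and R: "respects_embedding bad_tree bad_rot p"
    by blast
  have D: "L_drawing bad_tree p" "upward bad_tree p"
    using U by (auto simp: upward_planar_L_drawing_def planar_L_drawing_def)
  have "\<exists>k. sorted_wrt (ccw_before p 1) (rotate k (bad_rot 1))"
    "\<exists>k. sorted_wrt (ccw_before p 2) (rotate k (bad_rot 2))"
    using R by (simp_all add: respects_embedding_def bad_tree_def)
  then obtain k1 k2 where
    "sorted_wrt (ccw_before p 1) (rotate k1 [(3, 1), (0, 1), (4, 1), (1, 5)])"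
    "sorted_wrt (ccw_before p 2) (rotate k2 [(6, 2), (0, 2), (7, 2), (2, 8)])"
    by (auto simp: bad_rot_def)
  note s = in_arcs_left_to_right[OF D this(1)] in_arcs_left_to_right[OF D this(2)]
  \<comment> \<open>Vertices 1 and 2 each have to be at least as high as the other, but an L-drawing
    forbids equal heights.\<close>
  have "\<not> snd (p 1) < snd (p 2)"
    using s by (intro surrounded_out_neighbour_is_highest[OF U, of 0 1 2 3 4])
      (auto simp: bad_tree_def)
  moreover have "\<not> snd (p 2) < snd (p 1)"
    using s by (intro surrounded_out_neighbour_is_highest[OF U, of 0 2 1 6 7])
      (auto simp: bad_tree_def)
  moreover have "snd (p 1) \<noteq> snd (p 2)"
    using D by (auto simp: L_drawing_def bad_tree_def)
  ultimately show False
    by simp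
qed

section \<open>The counterexample is a directed tree\<close>

lemma pcas_consecutive:
  assumes "pcas u c v" "Suc i < length c"
  shows "fst (c ! Suc i) = snd (c ! i)"
  using assms
proof (induction u c v arbitrary: i rule: pcas.induct)
  case (2 u e es v)
  then show ?case
    by (cases i; cases es) auto
qed simp

lemma pcas_ends:
  assumes "pcas u c v" "c \<noteq> []"
  shows "fst (c ! 0) = u" "snd (c ! (length c - 1)) = v" "tl (pawalk_verts u c) = map snd c"
proof -
  show "fst (c ! 0) = u"
    using assms by (cases c) auto
  have "snd (last c) = v"
    using assms by (induction u c v rule: pcas.induct) auto
  then show "snd (c ! (length c - 1)) = v"
    using assms by (simp add: last_conv_nth)
  have "pawalk_verts u c = u # map snd c" if "pcas u c v" for u v
    using that by (induction u c v rule: pcas.induct) auto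
  then show "tl (pawalk_verts u c) = map snd c"
    using assms(1) by simp
qed

text \<open>
  Both neighbours of the maximal vertex of a cycle would have to be its parent.
\<close>

lemma no_cycle_if_parent_function:
  fixes H :: "'a::linorder pair_pre_digraph"
  assumes par: "\<And>x y. (x, y) \<in> parcs H \<Longrightarrow> x < y \<and> x = par y \<or> y < x \<and> y = par x"
  shows "\<not> (\<exists>c. pre_digraph.cycle (with_proj H) c \<and> 3 \<le> length c)"
proof
  assume "\<exists>c. pre_digraph.cycle (with_proj H) c \<and> 3 \<le> length c"
  then obtain c u where c: "set c \<subseteq> parcs H" "pcas u c u" "distinct (tl (pawalk_verts u c))"
      "3 \<le> length c"
    by (auto simp: pre_digraph.cycle_def pre_digraph.awalk_def cas_with_proj_eq
        awalk_verts_with_proj_eq)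
  define n where "n = length c"
  \<comment> \<open>The vertices of the cycle, indexed periodically so that the step from the last
    arc to the first is like any other.\<close>
  define s where "s i = snd (c ! (i mod n))" for i
  have n: "3 \<le> n" "c \<noteq> []"
    using c by (auto simp: n_def)
  have dist: "distinct (map snd c)"
    using c(3) pcas_ends(3)[OF c(2) n(2)] by simp
  have step: "(s i, s (Suc i)) \<in> parcs H" for i
  proof -
    have "Suc i mod n < n"
      using n by simp
    then have "c ! (Suc i mod n) \<in> parcs H"
      using c(1) nth_mem by (fastforce simp: n_def)
    moreover have "fst (c ! (Suc i mod n)) = s i"
    proof (cases "Suc (i mod n) = n")
      case True
      then have "Suc i mod n = 0" "i mod n = n - 1"
        by (auto simp: mod_Suc)
      then show ?thesis
        using pcas_ends[OF c(2) n(2)] by (simp add: s_def n_def)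
    next
      case False
      moreover have "i mod n < n"
        using n by simp
      ultimately show ?thesis
        using pcas_consecutive[OF c(2), of "i mod n"] by (simp add: mod_Suc s_def n_def)
    qed
    ultimately show ?thesis
      by (metis prod.collapse s_def)
  qed
  have s_eq: "s i = s j \<longleftrightarrow> i mod n = j mod n" for i j
    using dist n nth_eq_iff_index_eq[OF dist, of "i mod n" "j mod n"]
    by (simp add: s_def n_def)
  have "range s \<subseteq> snd ` set c"
    using n nth_mem by (fastforce simp: s_def n_def)
  then have fin: "finite (range s)"
    by (rule finite_subset) simp
  have "Max (range s) \<in> range s"
    by (rule Max_in[OF fin]) simp
  then obtain i where i: "s i = Max (range s)"
    by fastforce
  then have max: "s j \<le> s i" for j
    using fin by simp
  \<comment> \<open>Shifting by a full period keeps the predecessor index from being truncated when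
    \<open>i\<close> is 0.\<close>
  have "s (i + n) = s i"
    by (simp add: s_eq)
  then have "s (i + n - 1) = par (s i)" "s (i + n + 1) = par (s i)"
    using par[OF step[of "i + n - 1"]] par[OF step[of "i + n"]] max[of "i + n - 1"]
      max[of "i + n + 1"] n by auto
  \<comment> \<open>The two neighbours coincide although their indices differ by 2, which is
    impossible for \<open>n\<close> at least 3.\<close>
  then have "(i + n - 1) mod n = (i + n + 1) mod n"
    using s_eq by metis
  then have "n dvd (i + n + 1) - (i + n - 1)"
    using mod_eq_dvd_iff_nat[of "i + n - 1" "i + n + 1" n] by simp
  then have "n dvd 2"
    using n by simp
  then show False
    using n dvd_imp_le[of n 2] by simp
qed

lemma directed_tree_bad_tree: "directed_tree bad_tree"
proof -
  define H where "H = mk_symmetric (with_proj bad_tree)"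
  interpret pair_digraph bad_tree
    by unfold_locales (auto simp: bad_tree_def)
  interpret H: pair_wf_digraph H
    unfolding H_def by (rule wellformed_mk_symmetric)
  have H: "parcs H = parcs bad_tree \<union> (parcs bad_tree)\<inverse>" "pverts H = pverts bad_tree"
    by (auto simp: H_def parcs_mk_symmetric)
  have "\<not> (\<exists>c. pre_digraph.cycle (with_proj H) c \<and> 3 \<le> length c)"
    \<comment> \<open>The root 0 gets itself as a dummy parent; it is never the larger end of an
      arc.\<close>
    by (rule no_cycle_if_parent_function
        [where par = "\<lambda>v. if v \<le> 2 then 0 else if v \<le> 5 then 1 else 2"])
      (auto simp: H bad_tree_def)
  moreover have "strongly_connected (with_proj H)"
  proof
    let ?R = "\<lambda>u v. u \<rightarrow>\<^sup>*\<^bsub>with_proj H\<^esub> v"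
    have adj: "?R u v" if "(u, v) \<in> parcs H" for u v
      using that by (rule H.reachable_adjI)
    have "?R 0 0"
      by (rule H.reachable_refl) (simp add: H bad_tree_def)
    moreover have "?R 0 1" "?R 0 2"
      by (rule adj, simp add: H bad_tree_def)+
    moreover have "?R 1 3" "?R 1 4" "?R 1 5" "?R 2 6" "?R 2 7" "?R 2 8"
      by (rule adj, simp add: H bad_tree_def)+
    \<comment> \<open>Reachability from the root suffices because \<open>H\<close> is
      symmetric.\<close>
    ultimately have from_0: "?R 0 v" if "v \<in> pverts bad_tree" for v
      using that H.reachable_trans[of 0 1 v] H.reachable_trans[of 0 2 v]
      by (auto simp: bad_tree_def)
    fix u v
    assume "u \<in> verts (with_proj H)" "v \<in> verts (with_proj H)"
    then have "?R 0 u" "?R 0 v"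
      using from_0 by (auto simp: H)
    moreover have "symmetric (with_proj H)"
      unfolding H_def by (rule symmetric_mk_symmetric)
    ultimately show "?R u v"
      using symmetric_reachable H.reachable_trans by metis
  qed (simp add: H bad_tree_def)
  ultimately show ?thesis
    using pair_digraph_axioms by (auto simp: directed_tree_def connected_def H_def bad_tree_def)
qed

section \<open>The embedding is planar and bimodal\<close>

text \<open>Grouped by arcs instead of vertices, each of the 8 arcs contributes its two
  traversals.\<close>

lemma bad_tree_darts:
  "(SIGMA v : pverts bad_tree. incident_arcs bad_tree v) =
     {(2, 2, 8), (8, 2, 8), (7, 7, 2), (2, 7, 2), (6, 6, 2), (2, 6, 2), (1, 1, 5), (5, 1, 5),
      (4, 4, 1), (1, 4, 1), (3, 3, 1), (1, 3, 1), (0, 0, 2), (2, 0, 2), (0, 0, 1), (1, 0, 1)}"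
  (is "_ = ?D")
proof -
  have "\<forall>a\<in>parcs bad_tree. fst a \<in> pverts bad_tree \<and> snd a \<in> pverts bad_tree"
    by (simp add: bad_tree_def)
  then have "(SIGMA v : pverts bad_tree. incident_arcs bad_tree v) =
      (\<Union>a\<in>parcs bad_tree. {(fst a, a), (snd a, a)})"
    by (fastforce simp: incident_arcs_def in_arcs_def out_arcs_def)
  also have "\<dots> = ?D"
    by (simp add: bad_tree_def)
  finally show ?thesis .
qed

lemma face_bad_tree:
  "orbit (face_succ bad_rot) (0, 0, 1) = (SIGMA v : pverts bad_tree. incident_arcs bad_tree v)"
proof
  let ?f = "face_succ bad_rot"
  \<comment> \<open>The closed walk around the tree, which traverses every arc once in each
    direction.\<close>
  have f: "?f (0, 0, 1) = (1, 4, 1)" "?f (1, 4, 1) = (4, 4, 1)" "?f (4, 4, 1) = (1, 1, 5)"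
    "?f (1, 1, 5) = (5, 1, 5)" "?f (5, 1, 5) = (1, 3, 1)" "?f (1, 3, 1) = (3, 3, 1)"
    "?f (3, 3, 1) = (1, 0, 1)" "?f (1, 0, 1) = (0, 0, 2)" "?f (0, 0, 2) = (2, 7, 2)"
    "?f (2, 7, 2) = (7, 7, 2)" "?f (7, 7, 2) = (2, 2, 8)" "?f (2, 2, 8) = (8, 2, 8)"
    "?f (8, 2, 8) = (2, 6, 2)" "?f (2, 6, 2) = (6, 6, 2)" "?f (6, 6, 2) = (2, 0, 2)"
    "?f (2, 0, 2) = (0, 0, 1)"
    by (simp_all add: face_succ_def other_end_def bad_rot_def transpose_def)
  show "orbit ?f (0, 0, 1) \<subseteq> (SIGMA v : pverts bad_tree. incident_arcs bad_tree v)"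
  proof
    fix d
    assume "d \<in> orbit ?f (0, 0, 1)"
    then show "d \<in> (SIGMA v : pverts bad_tree. incident_arcs bad_tree v)"
      unfolding bad_tree_darts by induction (use f in auto)
  qed
  have "\<forall>d\<in>orbit ?f (0, 0, 1). ?f d \<in> orbit ?f (0, 0, 1)"
    by (simp add: orbit.step)
  \<comment> \<open>An \<open>orbit\<close> begins with the first successor; the starting pair is
    reached only by the last equation of \<open>f\<close>.\<close>
  then show "(SIGMA v : pverts bad_tree. incident_arcs bad_tree v) \<subseteq> orbit ?f (0, 0, 1)"
    unfolding bad_tree_darts using orbit.base[of ?f "(0, 0, 1)"] f
    by (metis (lifting) empty_subsetI insert_subset)
qed

text \<open>With a single face, Euler's formula reads 9 + 1 = 8 + 2.\<close>

lemma planar_embedding_bad_tree: "planar_embedding bad_tree bad_rot"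
proof -
  let ?D = "SIGMA v : pverts bad_tree. incident_arcs bad_tree v"
  have "rotation_system bad_tree bad_rot"
    by (auto simp: rotation_system_def bad_tree_def bad_rot_def incident_arcs_def in_arcs_def
        out_arcs_def)
  moreover have "(0, 0, 1) \<in> ?D"
    by (simp add: bad_tree_darts)
  \<comment> \<open>Cyclicity makes the orbit of every pair, not only of the traced one, equal to
    the whole set.\<close>
  then have "cyclic_on (face_succ bad_rot) ?D"
    unfolding cyclic_on_def using face_bad_tree by blast
  then have "faces bad_tree bad_rot = (\<lambda>_. ?D) ` ?D"
    unfolding faces_def by (intro image_cong refl orbit_cyclic_eq3)
  then have "faces bad_tree bad_rot = {?D}"
    by (auto simp: bad_tree_darts)
  ultimately show ?thesis
    by (simp add: planar_embedding_def bad_tree_def)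
qed

text \<open>Each list of \<open>bad_rot\<close> already has its incoming arcs first, so rotation by
  0 works.\<close>

lemma bimodal_bad_tree: "bimodal bad_tree bad_rot"
  unfolding bimodal_def
proof
  fix v
  assume v: "v \<in> pverts bad_tree"
  let ?ins = "filter (\<lambda>a. snd a = v) (bad_rot v)" and ?outs = "filter (\<lambda>a. fst a = v) (bad_rot v)"
  from v have "v = 0 \<or> v = 1 \<or> v = 2 \<or> v = 3 \<or> v = 4 \<or> v = 5 \<or> v = 6 \<or> v = 7 \<or> v = 8"
    by (simp add: bad_tree_def)
  then have "bad_rot v = ?ins @ ?outs \<and> set ?ins = in_arcs (with_proj bad_tree) v \<and>
      set ?outs = out_arcs (with_proj bad_tree) v"
    by (elim disjE) (auto simp: bad_tree_def bad_rot_def in_arcs_def out_arcs_def)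
  then show "\<exists>k ins outs. rotate k (bad_rot v) = ins @ outs \<and>
      set ins = in_arcs (with_proj bad_tree) v \<and> set outs = out_arcs (with_proj bad_tree) v"
    by (intro exI[of _ 0] exI[of _ ?ins] exI[of _ ?outs]) simp
qed

theorem theorem3:
  shows "(\<forall>G :: 'a pair_pre_digraph. directed_tree G \<longrightarrow>
            (\<exists>p. upward_leftward_planar_L_drawing G p)) \<and>
         (\<exists>(T :: nat pair_pre_digraph) rot.
            directed_tree T \<and> planar_embedding T rot \<and> bimodal T rot \<and>
            \<not> (\<exists>p. upward_planar_L_drawing T p \<and> respects_embedding T rot p))"
  by (intro conjI allI impI exI[of _ bad_tree] exI[of _ bad_rot] directed_tree_upward_leftward
      directed_tree_bad_tree planar_embedding_bad_tree bimodal_bad_tree bad_tree_no_drawing)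

end
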